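(* Let $G=([n],E)$ be a graph. Then: (1) $\operatorname{pmd}(G)\le \min(2n-3,|E|)$. (2) If $G$ is bipartite, then $\operatorname{pmd}(G)\le \min(n-1,|E|)$. (3) $\operatorname{pmd}(G)\ge \Delta(G)$, with equality if $G$ is a forest.
   Context: Graphs are finite simple graphs; $[n]=\{1,\dots,n\}$ with $n\ge 1$ an integer; a forest is a graph without cycles; $\Delta(G)$ denotes the maximal degree of a vertex of $G$, where the degree of a vertex is the number of edges containing it. A positive matching of a graph $G=(V,E)$ is a matching $M\subseteq E$ (a set of pairwise disjoint edges) such that there is a weight function $w:V\to\mathbb{R}$ with $w(i)+w(j)>0$ for every $\{i,j\}\in M$ and $w(i)+w(j)<0$ for every $\{i,j\}\in E\setminus M$. A positive matching decomposition of $G$ is a partition $E=\bigcup_{i=1}^p E_i$ into pairwise disjoint subsets such that $E_i$ is a positive matching of the graph $(V,E\setminus\bigcup_{j=1}^{i-1}E_j)$ for $i=1,\dots,p$. The sets $E_i$ are called the parts of the decomposition. The number $\operatorname{pmd}(G)$ is the smallest $p$ for which $G$ admits a positive matching decomposition with $p$ parts.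
   Formalization: For n = 1 the bound 2n−3 = −1 in (1) is false (the graph has no edges and pmd(G) = 0); there the bound is read as 0, and for n ≥ 2 nothing is changed. *)

theory Defs
  imports Complex_Main "HOL-Library.Disjoint_Sets"
begin

text \<open>
  A finite simple graph is given by its vertex set \<open>V\<close> and its set \<open>E\<close> of two-element edges.
  Notions that refer only to the edges do not carry \<open>V\<close> as a parameter.
\<close>

definition simple_graph :: "'a set \<Rightarrow> 'a set set \<Rightarrow> bool" where
  "simple_graph V E \<longleftrightarrow> finite V \<and> (\<forall>e\<in>E. e \<subseteq> V \<and> card e = 2)"

definition degree :: "'a set set \<Rightarrow> 'a \<Rightarrow> nat" where
  "degree E v = card {e \<in> E. v \<in> e}"

definition max_degree :: "'a set \<Rightarrow> 'a set set \<Rightarrow> nat" where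
  "max_degree V E = Max (degree E ` V)"

definition bipartite :: "'a set \<Rightarrow> 'a set set \<Rightarrow> bool" where
  "bipartite V E \<longleftrightarrow>
     (\<exists>A B. A \<union> B = V \<and> A \<inter> B = {} \<and> (\<forall>e\<in>E. \<exists>a\<in>A. \<exists>b\<in>B. e = {a, b}))"

text \<open>A cycle is the list of its vertices; the last vertex is not a repetition of the first one.\<close>

definition is_cycle :: "'a set set \<Rightarrow> 'a list \<Rightarrow> bool" where
  "is_cycle E c \<longleftrightarrow> 3 \<le> length c \<and> distinct c \<and>
     (\<forall>i < length c. {c ! i, c ! (Suc i mod length c)} \<in> E)"

definition forest :: "'a set set \<Rightarrow> bool" where
  "forest E \<longleftrightarrow> (\<nexists>c. is_cycle E c)"

definition matching :: "'a set set \<Rightarrow> 'a set set \<Rightarrow> bool" where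
  "matching E M \<longleftrightarrow> M \<subseteq> E \<and> disjoint M"

text \<open>The weight function is total; only its values on the vertices of edges matter.\<close>

definition positive_matching :: "'a set set \<Rightarrow> 'a set set \<Rightarrow> bool" where
  "positive_matching E M \<longleftrightarrow> matching E M \<and>
     (\<exists>w :: 'a \<Rightarrow> real.
        (\<forall>i j. {i, j} \<in> M \<longrightarrow> w i + w j > 0) \<and>
        (\<forall>i j. {i, j} \<in> E - M \<longrightarrow> w i + w j < 0))"

text \<open>
  The parts are \<open>P 1, \<dots>, P p\<close>. Empty parts are not excluded; the empty set is a
  positive matching, and omitting empty parts only shortens a decomposition.
\<close>

definition positive_matching_decomposition ::
    "'a set set \<Rightarrow> nat \<Rightarrow> (nat \<Rightarrow> 'a set set) \<Rightarrow> bool" where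
  "positive_matching_decomposition E p P \<longleftrightarrow>
     E = (\<Union>i\<in>{1..p}. P i) \<and> disjoint_family_on P {1..p} \<and>
     (\<forall>i\<in>{1..p}. positive_matching (E - (\<Union>j\<in>{1..<i}. P j)) (P i))"

definition pmd :: "'a set set \<Rightarrow> nat" where
  "pmd E = (LEAST p. \<exists>P. positive_matching_decomposition E p P)"

text \<open>The minimum is attained: the single edges form a decomposition.\<close>

lemma positive_matching_single_edge:
  assumes "\<forall>e\<in>E. card e = 2" and "e \<in> E"
  shows "positive_matching E {e}"
proof -
  define w :: "'a \<Rightarrow> real" where "w v = (if v \<in> e then 1 else -2)" for v
  have "w i + w j > 0" if "{i, j} \<in> {e}" for i j
    using that by (auto simp: w_def)
  moreover have "w i + w j < 0" if "{i, j} \<in> E - {e}" for i j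
  proof -
    have "\<not> {i, j} \<subseteq> e"
    proof
      assume sub: "{i, j} \<subseteq> e"
      have "finite e" using assms card.infinite by fastforce
      moreover have "card {i, j} = card e" using that assms by auto
      ultimately have "{i, j} = e" using sub card_subset_eq by blast
      with that show False by simp
    qed
    then show ?thesis by (auto simp: w_def)
  qed
  ultimately show ?thesis
    using assms(2) by (auto simp: positive_matching_def matching_def disjoint_def intro!: exI[of _ w])
qed

lemma positive_matching_decomposition_exists:
  assumes "simple_graph V E"
  shows "\<exists>P. positive_matching_decomposition E (card E) P"
proof -
  have "finite E"
    using assms finite_subset[of E "Pow V"] by (auto simp: simple_graph_def)
  then obtain h where h: "bij_betw h {1..card E} E"
    using ex_bij_betw_nat_finite_1 by blast
  then have inj: "inj_on h {1..card E}" and img: "h ` {1..card E} = E"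
    by (simp_all add: bij_betw_def)
  have "positive_matching (E - (\<Union>j\<in>{1..<i}. {h j})) {h i}" if i: "i \<in> {1..card E}" for i
  proof (rule positive_matching_single_edge)
    show "\<forall>e\<in>E - (\<Union>j\<in>{1..<i}. {h j}). card e = 2"
      using assms by (auto simp: simple_graph_def)
    have "h i \<noteq> h j" if "j \<in> {1..<i}" for j
      using inj_onD[OF inj, of i j] i that by auto
    moreover have "h i \<in> E"
      using img i by blast
    ultimately show "h i \<in> E - (\<Union>j\<in>{1..<i}. {h j})"
      by blast
  qed
  moreover have "E = (\<Union>i\<in>{1..card E}. {h i})"
    using img by blast
  moreover have "disjoint_family_on (\<lambda>i. {h i}) {1..card E}"
    using inj_onD[OF inj] by (force simp: disjoint_family_on_def)
  ultimately show ?thesis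
    unfolding positive_matching_decomposition_def by blast
qed

text \<open>
  In the bound \<open>2 * n - 3\<close> the subtraction on natural numbers truncates only for \<open>n = 1\<close>.
  There the graph has no edges and \<open>pmd E = 0\<close>, so the bound has to be read as \<open>0\<close>, not as \<open>- 1\<close>.
\<close>

end

theory Submission
  imports Defs
begin

text \<open>
  All upper bounds other than \<open>card E\<close> come from one construction. Let the vertices carry integer
  labels such that the neighbours of any vertex have distinct labels, and colour every edge by the
  sum of the labels of its ends. Edges of the same colour \<open>s\<close> are then disjoint, and subtracting
  \<open>s / 2\<close> from all labels, up to a small shift, yields weights whose sum is positive on the edges of
  colour \<open>s\<close> and negative on the edges of smaller colour. Hence removing the colour classes in
  decreasing order is a positive matching decomposition, and \<open>pmd E\<close> is at most the length of an
  interval that contains all colours (\<open>pmd_le_if_sum_labelling\<close>).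

  The labels \<open>1, \<dots>, n\<close> give the sums \<open>3, \<dots>, 2 * n - 1\<close>. In a bipartite graph, numbering each of
  the two sides separately from \<open>1\<close> on gives the sums \<open>2, \<dots>, n\<close>. In a forest every proper edge
  colouring arises from vertex labels, because a label can be propagated along the edges without
  ever closing a cycle; and a forest has a proper edge colouring with as many colours as its maximal
  degree. Both are obtained together by adding one pendant edge at a time
  (\<open>forest_sum_labelling\<close>).

  The lower bound holds because a part, being a matching, has at most one edge at a given vertex.
\<close>

section \<open>Degrees are lower bounds\<close>

lemma simple_graph_finite_edges:
  assumes "simple_graph V E"
  shows "finite E"
  using assms finite_subset[of E "Pow V"] by (auto simp: simple_graph_def)

lemma simple_graph_card_edge:
  assumes "simple_graph V E"
  shows "\<forall>e\<in>E. card e = 2"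
  using assms by (simp add: simple_graph_def)

lemma simple_graph_edge_neq:
  assumes "simple_graph V E" and "{x, y} \<in> E"
  shows "x \<noteq> y"
  using assms by (auto simp: simple_graph_def)

lemma degree_le_parts:
  assumes "finite E" and dec: "positive_matching_decomposition E p P"
  shows "degree E v \<le> p"
proof -
  have E: "E = (\<Union>i\<in>{1..p}. P i)"
    using dec by (simp add: positive_matching_decomposition_def)
  have one: "card {e \<in> P i. v \<in> e} \<le> 1" if "i \<in> {1..p}" for i
  proof -
    have "disjoint (P i)"
      using dec that
      by (simp add: positive_matching_decomposition_def positive_matching_def matching_def)
    then have "\<forall>a\<in>{e \<in> P i. v \<in> e}. \<forall>b\<in>{e \<in> P i. v \<in> e}. a = b"
      by (auto simp: disjoint_def)
    moreover have "P i \<subseteq> E"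
      using E that by blast
    then have "finite {e \<in> P i. v \<in> e}"
      using \<open>finite E\<close> by (simp add: finite_subset)
    ultimately show ?thesis
      by (simp only: One_nat_def card_le_Suc0_iff_eq)
  qed
  have "{e \<in> E. v \<in> e} = (\<Union>i\<in>{1..p}. {e \<in> P i. v \<in> e})"
    using E by auto
  then have "degree E v \<le> (\<Sum>i\<in>{1..p}. card {e \<in> P i. v \<in> e})"
    by (simp add: degree_def card_UN_le)
  also have "\<dots> \<le> (\<Sum>i\<in>{1..p}. 1)"
    using one by (intro sum_mono) auto
  finally show ?thesis
    by simp
qed

lemma degree_le_max_degree:
  assumes "simple_graph V E" and "v \<in> V"
  shows "degree E v \<le> max_degree V E"
  using assms by (simp add: max_degree_def simple_graph_def)

lemma max_degree_le_pmd:
  assumes "simple_graph V E" and "V \<noteq> {}"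
  shows "max_degree V E \<le> pmd E"
proof -
  have "\<exists>P. positive_matching_decomposition E (pmd E) P"
    using positive_matching_decomposition_exists[OF assms(1)] unfolding pmd_def by (rule LeastI)
  then obtain P where "positive_matching_decomposition E (pmd E) P" ..
  then have "degree E v \<le> pmd E" for v
    by (rule degree_le_parts[OF simple_graph_finite_edges[OF assms(1)]])
  moreover have "finite V"
    using assms(1) by (simp add: simple_graph_def)
  ultimately show ?thesis
    using assms(2) by (simp add: max_degree_def)
qed

section \<open>Decompositions from vertex labels\<close>

text \<open>
  The first condition says that edges at a common vertex have different sums, so that the sums form
  a proper edge colouring. The second one confines them to an interval of \<open>p\<close> integers, whose
  position \<open>l\<close> is a parameter because shifting all labels moves it by even amounts only.
\<close>

definition sum_labelling :: "'a set set \<Rightarrow> int \<Rightarrow> nat \<Rightarrow> ('a \<Rightarrow> int) \<Rightarrow> bool" where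
  "sum_labelling E l p f \<longleftrightarrow>
     (\<forall>v x y. {v, x} \<in> E \<longrightarrow> {v, y} \<in> E \<longrightarrow> f x = f y \<longrightarrow> x = y) \<and>
     (\<forall>x y. {x, y} \<in> E \<longrightarrow> f x + f y \<in> {l<..l + int p})"

lemma sum_labellingI:
  assumes "\<And>v x y. {v, x} \<in> E \<Longrightarrow> {v, y} \<in> E \<Longrightarrow> f x = f y \<Longrightarrow> x = y"
    and "\<And>x y. {x, y} \<in> E \<Longrightarrow> f x + f y \<in> {l<..l + int p}"
  shows "sum_labelling E l p f"
  using assms unfolding sum_labelling_def by blast

text \<open>
  With the labels lowered by \<open>s / 2 - 1 / 4\<close>, the weight of an edge with sum \<open>t\<close> is
  \<open>t - s + 1 / 2\<close>, which for integers \<open>t \<le> s\<close> is positive exactly if \<open>t = s\<close>.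
\<close>

lemma positive_matching_top_sum:
  fixes f :: "'a \<Rightarrow> int"
  assumes pairs: "\<forall>e\<in>E. card e = 2"
    and inj: "\<And>v x y. {v, x} \<in> E \<Longrightarrow> {v, y} \<in> E \<Longrightarrow> f x = f y \<Longrightarrow> x = y"
    and top: "\<forall>e\<in>E. sum f e \<le> s"
  shows "positive_matching E {e \<in> E. sum f e = s}"
proof -
  have sum_pair: "sum f {i, j} = f i + f j" if "{i, j} \<in> E" for i j
    using pairs that by (cases "i = j") auto
  have "disjoint {e \<in> E. sum f e = s}"
  proof (rule disjointI)
    fix a b
    assume a: "a \<in> {e \<in> E. sum f e = s}" and b: "b \<in> {e \<in> E. sum f e = s}" and "a \<noteq> b"
    show "a \<inter> b = {}"
    proof (rule ccontr)
      assume "a \<inter> b \<noteq> {}"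
      then obtain v where v: "v \<in> a" "v \<in> b" by blast
      have "\<exists>x. e = {v, x}" if "e \<in> E" "v \<in> e" for e
        using pairs that by (fastforce simp: card_2_iff)
      then obtain x y where xy: "a = {v, x}" "b = {v, y}"
        using a b v by blast
      then have "f x = f y"
        using a b sum_pair by force
      then have "x = y"
        using inj[of v x y] a b xy by blast
      then show False
        using xy \<open>a \<noteq> b\<close> by simp
    qed
  qed
  moreover define w :: "'a \<Rightarrow> real" where "w v = of_int (f v) - of_int s / 2 + 1 / 4" for v
  have w: "w i + w j = of_int (f i + f j - s) + 1 / 2" for i j
    by (simp add: w_def)
  have "w i + w j > 0" if "{i, j} \<in> {e \<in> E. sum f e = s}" for i j
    using that sum_pair[of i j] by (simp add: w)
  moreover have "w i + w j < 0" if "{i, j} \<in> E - {e \<in> E. sum f e = s}" for i j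
  proof -
    have "f i + f j - s \<le> -1"
      using that sum_pair[of i j] top by force
    then have "real_of_int (f i + f j - s) \<le> -1"
      by linarith
    then show ?thesis
      by (simp only: w)
  qed
  ultimately show ?thesis
    unfolding positive_matching_def matching_def by blast
qed

lemma pmd_le_if_sum_labelling:
  assumes pairs: "\<forall>e\<in>E. card e = 2" and f: "sum_labelling E l p f"
  shows "pmd E \<le> p"
proof -
  \<comment> \<open>The classes are indexed from the largest sum \<open>l + p\<close> down to the smallest one \<open>l + 1\<close>.\<close>
  define P where "P i = {e \<in> E. sum f e = l + int p + 1 - int i}" for i
  have sums: "sum f e \<in> {l<..l + int p}" if e: "e \<in> E" for e
  proof -
    obtain x y where "e = {x, y}" "x \<noteq> y"
      using pairs e by (meson card_2_iff)
    then show ?thesis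
      using f e unfolding sum_labelling_def by simp
  qed
  have class_index: "e \<in> P i \<longleftrightarrow> i = nat (l + int p + 1 - sum f e)" if "e \<in> E" for e i
    using sums[OF that] that by (auto simp: P_def)
  have "E = (\<Union>i\<in>{1..p}. P i)"
  proof
    show "E \<subseteq> (\<Union>i\<in>{1..p}. P i)"
    proof
      fix e
      assume e: "e \<in> E"
      have "nat (l + int p + 1 - sum f e) \<in> {1..p}"
        using sums[OF e] by auto
      then show "e \<in> (\<Union>i\<in>{1..p}. P i)"
        using class_index[OF e] by blast
    qed
  qed (auto simp: P_def)
  moreover have "disjoint_family_on P {1..p}"
    by (auto simp: disjoint_family_on_def P_def)
  moreover have "positive_matching (E - (\<Union>j\<in>{1..<i}. P j)) (P i)" if i: "i \<in> {1..p}" for i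
  proof -
    let ?R = "E - (\<Union>j\<in>{1..<i}. P j)" and ?s = "l + int p + 1 - int i"
    have top: "sum f e \<le> ?s" if e: "e \<in> ?R" for e
    proof (rule ccontr)
      assume "\<not> sum f e \<le> ?s"
      then have "nat (l + int p + 1 - sum f e) \<in> {1..<i}"
        using sums[of e] e by auto
      then show False
        using class_index[of e] e by blast
    qed
    have "positive_matching ?R {e \<in> ?R. sum f e = ?s}"
    proof (rule positive_matching_top_sum)
      show "\<forall>e\<in>?R. card e = 2"
        using pairs by blast
      show "x = y" if "{v, x} \<in> ?R" "{v, y} \<in> ?R" "f x = f y" for v x y
        using f that unfolding sum_labelling_def by blast
      show "\<forall>e\<in>?R. sum f e \<le> ?s"
        using top by blast
    qed
    also have "{e \<in> ?R. sum f e = ?s} = P i"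
      by (auto simp: P_def)
    finally show ?thesis .
  qed
  ultimately have "\<exists>P. positive_matching_decomposition E p P"
    unfolding positive_matching_decomposition_def by (intro exI[of _ P] conjI ballI)
  then show ?thesis
    unfolding pmd_def by (rule Least_le)
qed

section \<open>General and bipartite graphs\<close>

lemma pmd_le_double:
  assumes "simple_graph {1..n} E"
  shows "pmd E \<le> 2 * n - 3"
proof (rule pmd_le_if_sum_labelling)
  show "\<forall>e\<in>E. card e = 2"
    using simple_graph_card_edge[OF assms] .
  show "sum_labelling E 2 (2 * n - 3) int"
  proof (rule sum_labellingI)
    show "x = y" if "int x = int y" for x y
      using that by simp
    show "int x + int y \<in> {2<..2 + int (2 * n - 3)}" if e: "{x, y} \<in> E" for x y
    proof -
      have "x \<noteq> y"
        using simple_graph_edge_neq[OF assms e] .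
      moreover have "{x, y} \<subseteq> {1..n}"
        using assms e unfolding simple_graph_def by blast
      ultimately show ?thesis
        by auto
    qed
  qed
qed

lemma pmd_bipartite_le:
  assumes G: "simple_graph V E" and "bipartite V E"
  shows "pmd E \<le> card V - 1"
proof -
  obtain A B where V: "A \<union> B = V" and AB: "A \<inter> B = {}"
    and E: "\<forall>e\<in>E. \<exists>a\<in>A. \<exists>b\<in>B. e = {a, b}"
    using assms(2) unfolding bipartite_def by (elim exE conjE)
  have fin: "finite A" "finite B"
    using G V by (auto simp: simple_graph_def)
  obtain g where g: "bij_betw g A {1..card A}"
    using bij_betw_inv ex_bij_betw_nat_finite_1[OF fin(1)] by blast
  obtain h where h: "bij_betw h B {1..card B}"
    using bij_betw_inv ex_bij_betw_nat_finite_1[OF fin(2)] by blast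
  define f where "f v = int (if v \<in> A then g v else h v)" for v
  have fA: "f a = int (g a)" if "a \<in> A" for a
    using that by (simp add: f_def)
  have fB: "f b = int (h b)" if "b \<in> B" for b
    using that AB by (auto simp: f_def)
  have sides: "x \<in> A \<and> y \<in> B \<or> x \<in> B \<and> y \<in> A" if "{x, y} \<in> E" for x y
    using bspec[OF E that] by (auto simp: doubleton_eq_iff)
  have card: "card A + card B = card V"
    using card_Un_disjoint[OF fin AB] V by simp
  have "x = y" if vx: "{v, x} \<in> E" and vy: "{v, y} \<in> E" and eq: "f x = f y" for v x y
  proof -
    have "x \<in> A \<and> y \<in> A \<or> x \<in> B \<and> y \<in> B"
      using sides[OF vx] sides[OF vy] AB by blast
    then show ?thesis
      using eq g h fA fB by (auto simp: bij_betw_def dest: inj_onD)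
  qed
  moreover have "f x + f y \<in> {1<..1 + int (card V - 1)}" if "{x, y} \<in> E" for x y
  proof -
    have A: "f a \<in> {1..int (card A)}" if "a \<in> A" for a
      using bij_betwE[OF g] fA[OF that] that by auto
    have B: "f b \<in> {1..int (card B)}" if "b \<in> B" for b
      using bij_betwE[OF h] fB[OF that] that by auto
    show ?thesis
      using sides[OF that] A[of x] A[of y] B[of x] B[of y] card by auto
  qed
  ultimately have "sum_labelling E 1 (card V - 1) f"
    by (rule sum_labellingI)
  then show ?thesis
    by (rule pmd_le_if_sum_labelling[OF simple_graph_card_edge[OF G]])
qed

section \<open>Forests\<close>

lemma forest_mono:
  assumes "forest E" and "F \<subseteq> E"
  shows "forest F"
  using assms unfolding forest_def is_cycle_def by blast

text \<open>
  The first vertex of a longest path has all its neighbours on the path. A neighbour other than the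
  second vertex would close a cycle with an initial segment of the path.
\<close>

lemma forest_pendant_edge:
  assumes G: "simple_graph V E" and "forest E" and "E \<noteq> {}"
  shows "\<exists>u v. {u, v} \<in> E \<and> (\<forall>e\<in>E. v \<in> e \<longrightarrow> e = {u, v})"
proof -
  define path where "path c \<longleftrightarrow> distinct c \<and> set c \<subseteq> V \<and> 2 \<le> length c \<and>
    (\<forall>i. Suc i < length c \<longrightarrow> {c ! i, c ! Suc i} \<in> E)" for c
  have edge: "x \<noteq> y \<and> x \<in> V \<and> y \<in> V" if "{x, y} \<in> E" for x y
    using G that simple_graph_edge_neq[OF G that] by (auto simp: simple_graph_def)
  obtain e where "e \<in> E"
    using \<open>E \<noteq> {}\<close> by blast
  then obtain a b where "{a, b} \<in> E"
    using G by (metis card_2_iff simple_graph_def)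
  then have "path [a, b]"
    using edge[of a b] by (auto simp: path_def nth_Cons split: nat.splits)
  have "finite V"
    using G by (simp add: simple_graph_def)
  then have "\<forall>d. path d \<longrightarrow> length d < Suc (card V)"
    using card_mono[of V] by (auto simp: path_def less_Suc_eq_le simp flip: distinct_card)
  then have "\<exists>c. path c \<and> (\<forall>d. path d \<longrightarrow> length d \<le> length c)"
    by (rule ex_has_greatest_nat[of path, OF \<open>path [a, b]\<close>])
  then obtain c where c: "path c" and longest: "\<forall>d. path d \<longrightarrow> length d \<le> length c"
    by (elim exE conjE)
  let ?v = "c ! 0" and ?u = "c ! 1"
  have len: "2 \<le> length c" and dist: "distinct c"
    using c by (auto simp: path_def)
  have uv: "{?u, ?v} \<in> E"
    using c len by (auto simp: path_def insert_commute)
  have "e = {?u, ?v}" if e: "e \<in> E" "?v \<in> e" for e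
  proof -
    obtain y where y: "e = {?v, y}"
      using G e by (fastforce simp: simple_graph_def card_2_iff)
    then have yE: "{?v, y} \<in> E"
      using e by simp
    have "y \<in> set c"
    proof (rule ccontr)
      assume "y \<notin> set c"
      then have "path (y # c)"
        using c yE edge[OF yE]
        by (auto simp: path_def nth_Cons insert_commute split: nat.splits)
      then show False
        using longest by fastforce
    qed
    then obtain k where k: "k < length c" "y = c ! k"
      by (auto simp: in_set_conv_nth)
    have "k \<noteq> 0"
      using edge[OF yE] k by metis
    have "k < 2"
    proof (rule ccontr)
      assume "\<not> k < 2"
      have len_cycle: "length (take (Suc k) c) = Suc k"
        using k by simp
      have "{take (Suc k) c ! i, take (Suc k) c ! (Suc i mod Suc k)} \<in> E" if "i < Suc k" for i
      proof (cases "i = k")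
        case True
        then show ?thesis
          using yE k by (simp add: insert_commute)
      next
        case False
        then show ?thesis
          using c k that by (auto simp: path_def)
      qed
      then have "is_cycle E (take (Suc k) c)"
        using \<open>\<not> k < 2\<close> dist unfolding is_cycle_def len_cycle by simp
      then show False
        using \<open>forest E\<close> by (auto simp: forest_def)
    qed
    then have "k = 1"
      using \<open>k \<noteq> 0\<close> by simp
    then show ?thesis
      using y k by (simp add: insert_commute)
  qed
  then have "\<forall>e\<in>E. ?v \<in> e \<longrightarrow> e = {?u, ?v}"
    by (intro ballI impI)
  with uv show ?thesis
    by (intro exI conjI)
qed

text \<open>
  Without its pendant edge \<open>{u, v}\<close> the forest has a labelling by induction. The vertex \<open>u\<close> has
  then fewer than \<open>p\<close> neighbours, so one of the \<open>p\<close> sums does not occur at \<open>u\<close>. As \<open>v\<close> lies on no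
  other edge, its label can be chosen such that \<open>{u, v}\<close> gets this sum.
\<close>

lemma forest_sum_labelling:
  assumes "simple_graph V E" and "forest E" and "\<forall>v\<in>V. degree E v \<le> p"
  shows "\<exists>f. sum_labelling E 0 p f"
  using simple_graph_finite_edges[OF assms(1)] assms
proof (induction E rule: finite_psubset_induct)
  case (psubset E)
  note G = \<open>simple_graph V E\<close>
  show ?case
  proof (cases "E = {}")
    case True
    then show ?thesis
      by (simp add: sum_labelling_def)
  next
    case False
    obtain u v where uv: "{u, v} \<in> E" and pendant: "\<forall>e\<in>E. v \<in> e \<longrightarrow> e = {u, v}"
      using forest_pendant_edge[OF G \<open>forest E\<close> False] by (elim exE conjE)
    have "u \<noteq> v"
      using simple_graph_edge_neq[OF G uv] .
    have "u \<in> V"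
      using G uv by (auto simp: simple_graph_def)
    let ?F = "E - {{u, v}}"
    have "degree ?F x \<le> degree E x" for x
      using psubset.hyps unfolding degree_def by (intro card_mono) auto
    then have "\<forall>x\<in>V. degree ?F x \<le> p"
      using psubset.prems(3) le_trans by blast
    moreover have "simple_graph V ?F"
      using G by (simp add: simple_graph_def)
    moreover have "forest ?F"
      using \<open>forest E\<close> forest_mono by blast
    ultimately obtain f where f: "sum_labelling ?F 0 p f"
      using psubset.IH[of ?F] uv by blast
    define N where "N = {e \<in> ?F. u \<in> e}"
    have "finite N"
      using psubset.hyps by (simp add: N_def)
    have "card N < card {e \<in> E. u \<in> e}"
      using psubset.hyps uv by (intro psubset_card_mono) (auto simp: N_def)
    also have "\<dots> \<le> p"
      using psubset.prems(3) \<open>u \<in> V\<close> by (simp add: degree_def)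
    finally have "card (sum f ` N) < card {1..int p}"
      using card_image_le[OF \<open>finite N\<close>, of "sum f"] by simp
    then have "\<not> {1..int p} \<subseteq> sum f ` N"
      using card_mono[of "sum f ` N" "{1..int p}"] \<open>finite N\<close> by auto
    then obtain s where s: "s \<in> {1..int p}" "s \<notin> sum f ` N"
      by blast
    define g where "g = f(v := s - f u)"
    have old: "x \<noteq> v \<and> y \<noteq> v \<and> g x = f x \<and> g y = f y" if "{x, y} \<in> ?F" for x y
      using that bspec[OF pendant, of "{x, y}"] by (auto simp: g_def)
    have new: "x = u \<and> y = v \<or> x = v \<and> y = u" if "{x, y} \<in> E" "{x, y} \<notin> ?F" for x y
      using that by (auto simp: doubleton_eq_iff)
    have free: "g y \<noteq> g v" if uy: "{u, y} \<in> ?F" for y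
    proof
      assume "g y = g v"
      then have "f u + f y = s"
        using old[OF uy] by (simp add: g_def)
      moreover have "u \<noteq> y"
        using simple_graph_edge_neq[OF G, of u y] uy by blast
      moreover have "{u, y} \<in> N"
        using uy by (simp add: N_def)
      ultimately have "s \<in> sum f ` N"
        by (intro image_eqI[of _ _ "{u, y}"]) auto
      then show False
        using s by simp
    qed
    have "y = z" if xy: "{x, y} \<in> E" and xz: "{x, z} \<in> E" and eq: "g y = g z" for x y z
    proof (cases "{x, y} \<in> ?F"; cases "{x, z} \<in> ?F")
      assume "{x, y} \<in> ?F" "{x, z} \<in> ?F"
      then show ?thesis
        using old[of x y] old[of x z] eq f unfolding sum_labelling_def by metis
    next
      assume "{x, y} \<in> ?F" "{x, z} \<notin> ?F"
      then show ?thesis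
        using old[of x y] new[OF xz] free[of y] eq by auto
    next
      assume "{x, y} \<notin> ?F" "{x, z} \<in> ?F"
      then show ?thesis
        using old[of x z] new[OF xy] free[of z] eq by auto
    next
      assume "{x, y} \<notin> ?F" "{x, z} \<notin> ?F"
      then show ?thesis
        using new[OF xy] new[OF xz] \<open>u \<noteq> v\<close> by auto
    qed
    moreover have "g x + g y \<in> {0<..0 + int p}" if xy: "{x, y} \<in> E" for x y
    proof (cases "{x, y} \<in> ?F")
      case True
      then show ?thesis
        using old[OF True] f unfolding sum_labelling_def by simp
    next
      case False
      then show ?thesis
        using new[OF xy False] s \<open>u \<noteq> v\<close> by (auto simp: g_def)
    qed
    ultimately have "sum_labelling E 0 p g"
      by (rule sum_labellingI)
    then show ?thesis
      by blast
  qed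
qed

lemma pmd_forest_le_max_degree:
  assumes G: "simple_graph V E" and "forest E"
  shows "pmd E \<le> max_degree V E"
proof -
  obtain f where "sum_labelling E 0 (max_degree V E) f"
    using forest_sum_labelling[OF assms] degree_le_max_degree[OF G] by blast
  then show ?thesis
    by (rule pmd_le_if_sum_labelling[OF simple_graph_card_edge[OF G]])
qed

section \<open>The bounds\<close>

theorem lemma5p4:
  fixes n :: nat and E :: "nat set set"
  assumes "n \<ge> 1" and "simple_graph {1..n} E"
  shows "pmd E \<le> min (2 * n - 3) (card E) \<and>
    (bipartite {1..n} E \<longrightarrow> pmd E \<le> min (n - 1) (card E)) \<and>
    max_degree {1..n} E \<le> pmd E \<and>
    (forest E \<longrightarrow> pmd E = max_degree {1..n} E)"
proof -
  have "pmd E \<le> card E"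
    unfolding pmd_def using positive_matching_decomposition_exists[OF assms(2)] by (rule Least_le)
  moreover have "max_degree {1..n} E \<le> pmd E"
    using assms by (intro max_degree_le_pmd) auto
  ultimately show ?thesis
    using pmd_le_double[OF assms(2)] pmd_bipartite_le[OF assms(2)]
      pmd_forest_le_max_degree[OF assms(2)] by auto
qed

end
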